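(* Let $G$ be a finite non-abelian AC-group with center $Z(G)$, and let $X_1,\dots,X_n$ be the distinct centralizers of non-central elements of $G$. Then $$\text{L-Spec}(\Gamma_G)=\{0^n,\ (|X_1|-|Z(G)|)^{|X_1|-|Z(G)|-1},\ \dots,\ (|X_n|-|Z(G)|)^{|X_n|-|Z(G)|-1}\}$$ and $$\begin{aligned}\text{Q-Spec}(\Gamma_G)=\{&(2(|X_1|-|Z(G)|)-2)^1,\ (|X_1|-|Z(G)|-2)^{|X_1|-|Z(G)|-1},\ \dots,\\ &(2(|X_n|-|Z(G)|)-2)^1,\ (|X_n|-|Z(G)|-2)^{|X_n|-|Z(G)|-1}\}.\end{aligned}$$
   Context: A group $G$ is called an AC-group if the centralizer $C_G(x)=\{y\in G: xy=yx\}$ is abelian for every $x\in G\setminus Z(G)$. The commuting graph $\Gamma_G$ of a finite non-abelian group $G$ is the simple undirected graph with vertex set $G\setminus Z(G)$ in which two distinct vertices $x,y$ are adjacent if and only if $xy=yx$. For a finite graph $\mathcal{G}$ with adjacency matrix $A$ and (diagonal) degree matrix $D$, $\text{L-Spec}(\mathcal{G})$ and $\text{Q-Spec}(\mathcal{G})$ denote the multisets of eigenvalues (with multiplicity) of the Laplacian matrix $D-A$ and of the signless Laplacian matrix $D+A$, respectively. The notation $\{\alpha_1^{a_1},\dots,\alpha_l^{a_l}\}$ means the multiset in which $\alpha_i$ is listed $a_i$ times (if listed values coincide, their multiplicities add; an exponent $0$ means the value does not appear). *)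

theory Defs
  imports
    "HOL-Algebra.Group"
    "HOL-Library.Multiset"
    "HOL-Computational_Algebra.Polynomial"
    "Jordan_Normal_Form.Char_Poly"
    "Graph_Theory.Pair_Digraph"
begin

definition centralizer :: "('a, 'b) monoid_scheme \<Rightarrow> 'a \<Rightarrow> 'a set" where
  "centralizer G x = {y \<in> carrier G. x \<otimes>\<^bsub>G\<^esub> y = y \<otimes>\<^bsub>G\<^esub> x}"

definition center :: "('a, 'b) monoid_scheme \<Rightarrow> 'a set" where
  "center G = {x \<in> carrier G. \<forall>y\<in>carrier G. x \<otimes>\<^bsub>G\<^esub> y = y \<otimes>\<^bsub>G\<^esub> x}"

definition AC_group :: "('a, 'b) monoid_scheme \<Rightarrow> bool" where
  "AC_group G \<longleftrightarrow> group G \<and>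
     (\<forall>x\<in>carrier G - center G. comm_group (G\<lparr>carrier := centralizer G x\<rparr>))"

text \<open>A simple undirected graph is a \<^locale>\<open>pair_graph\<close>: a finite loop-free digraph whose arc
  relation is symmetric, so that each edge is a pair of opposite arcs.\<close>

definition commuting_graph :: "('a, 'b) monoid_scheme \<Rightarrow> 'a pair_pre_digraph" where
  "commuting_graph G =
     \<lparr> pverts = carrier G - center G,
       parcs = {(x, y). x \<in> carrier G - center G \<and> y \<in> carrier G - center G \<and>
                        x \<noteq> y \<and> x \<otimes>\<^bsub>G\<^esub> y = y \<otimes>\<^bsub>G\<^esub> x} \<rparr>"

lemma pair_graph_commuting_graph:
  assumes "finite (carrier G)"
  shows "pair_graph (commuting_graph G)"
proof -
  have fin: "finite (parcs (commuting_graph G))"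
    by (rule finite_subset[of _ "carrier G \<times> carrier G"])
      (use assms in \<open>auto simp: commuting_graph_def\<close>)
  have sym: "symmetric (with_proj (commuting_graph G))"
    by (auto simp: symmetric_def sym_def commuting_graph_def)
  show ?thesis
    by unfold_locales (use assms fin sym in \<open>auto simp: commuting_graph_def\<close>)
qed

text \<open>Matrices are indexed by \<open>{0..<length vs}\<close>, so the vertices have to be listed: in the
  following, \<open>vs\<close> is a list in which each vertex of \<open>g\<close> occurs exactly once. Two such lists give
  matrices that differ by a simultaneous permutation of rows and columns.
  In a simple undirected graph the degree of a vertex is its out-degree in the symmetric digraph.\<close>

definition adjacency_mat :: "'a pair_pre_digraph \<Rightarrow> 'a list \<Rightarrow> complex mat" where
  "adjacency_mat g vs = mat (length vs) (length vs)
     (\<lambda>(i, j). if (vs ! i, vs ! j) \<in> parcs g then 1 else 0)"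

definition degree_mat :: "'a pair_pre_digraph \<Rightarrow> 'a list \<Rightarrow> complex mat" where
  "degree_mat g vs = mat (length vs) (length vs)
     (\<lambda>(i, j). if i = j then of_nat (out_degree (with_proj g) (vs ! i)) else 0)"

text \<open>Eigenvalues are counted with their algebraic multiplicity. They are taken in the complex
  numbers, where the characteristic polynomial splits, so that none is lost.\<close>

definition eigenvalue_mset :: "complex mat \<Rightarrow> complex multiset" where
  "eigenvalue_mset A = proots (char_poly A)"

definition L_Spec :: "'a pair_pre_digraph \<Rightarrow> 'a list \<Rightarrow> complex multiset" where
  "L_Spec g vs = eigenvalue_mset (degree_mat g vs - adjacency_mat g vs)"

definition Q_Spec :: "'a pair_pre_digraph \<Rightarrow> 'a list \<Rightarrow> complex multiset" where
  "Q_Spec g vs = eigenvalue_mset (degree_mat g vs + adjacency_mat g vs)"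

end

theory Submission
  imports Defs
begin

text \<open>In an AC-group, commuting is an equivalence relation on the non-central elements, whose
  classes are the sets \<open>X\<^sub>i - Z(G)\<close>. Hence the commuting graph is a disjoint union of complete
  graphs, and up to a simultaneous permutation of rows and columns the Laplacian and signless
  Laplacian matrices are block diagonal with blocks of the form \<open>a I + b J\<close>, where \<open>J\<close> is the
  all-ones matrix. A block of size \<open>m\<close> has the eigenvalue \<open>a + m b\<close> on the all-ones vector and
  \<open>a\<close> with multiplicity \<open>m - 1\<close>.\<close>

section \<open>Characteristic polynomials under reindexing and block decomposition\<close>

lemma det_permute_rows_cols:
  fixes A :: "'a :: comm_ring_1 mat"
  assumes A: "A \<in> carrier_mat n n" and p: "p permutes {0..<n}"
  shows "det (mat n n (\<lambda>(i, j). A $$ (p i, p j))) = det A"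
proof -
  define B where "B = mat n n (\<lambda>(i, j). A $$ (p i, j))"
  have lt: "p i < n" if "i < n" for i
    using permutes_in_image[OF p, of i] that by auto
  \<comment> \<open>Transposition turns the column permutation into a row permutation. Rows are thus
    permuted twice, and the two factors \<open>signof p\<close> cancel.\<close>
  have "det (mat n n (\<lambda>(i, j). A $$ (p i, p j)))
      = det (transpose_mat (mat n n (\<lambda>(i, j). A $$ (p i, p j))))"
    by (rule det_transpose[symmetric]) auto
  also have "transpose_mat (mat n n (\<lambda>(i, j). A $$ (p i, p j)))
      = mat n n (\<lambda>(i, j). transpose_mat B $$ (p i, j))"
    by (rule eq_matI) (auto simp: B_def lt)
  also have "det \<dots> = signof p * det (transpose_mat B)"
    by (rule det_permute_rows[OF _ p]) (auto simp: B_def)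
  also have "det (transpose_mat B) = det B"
    by (rule det_transpose[of _ n]) (auto simp: B_def)
  also have "det B = signof p * det A"
    unfolding B_def by (rule det_permute_rows[OF A p])
  also have "signof p * (signof p * det A) = det A"
    by (simp add: sign_def)
  finally show ?thesis .
qed

lemma char_poly_permute:
  fixes A :: "'a :: comm_ring_1 mat"
  assumes A: "A \<in> carrier_mat n n" and p: "p permutes {0..<n}"
  shows "char_poly (mat n n (\<lambda>(i, j). A $$ (p i, p j))) = char_poly A"
proof -
  have lt: "p i < n" if "i < n" for i
    using permutes_in_image[OF p, of i] that by auto
  \<comment> \<open>Injectivity keeps the indeterminate on the diagonal, so passing to
    \<open>char_poly_matrix\<close> commutes with the reindexing.\<close>
  have inj: "p i = p j \<longleftrightarrow> i = j" for i j
    using permutes_inj[OF p] by (auto dest: injD)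
  have "char_poly_matrix (mat n n (\<lambda>(i, j). A $$ (p i, p j)))
      = mat n n (\<lambda>(i, j). char_poly_matrix A $$ (p i, p j))"
    using A by (intro eq_matI) (auto simp: char_poly_matrix_def lt inj)
  then show ?thesis
    unfolding char_poly_def using det_permute_rows_cols[OF char_poly_matrix_closed[OF A] p] by simp
qed

lemma char_poly_block_diag:
  fixes A B :: "'a :: idom mat"
  assumes A: "A \<in> carrier_mat n n" and B: "B \<in> carrier_mat m m"
  shows "char_poly (four_block_mat A (0\<^sub>m n m) (0\<^sub>m m n) B) = char_poly A * char_poly B"
proof -
  have "char_poly_matrix (four_block_mat A (0\<^sub>m n m) (0\<^sub>m m n) B)
      = four_block_mat (char_poly_matrix A) (0\<^sub>m n m) (0\<^sub>m m n) (char_poly_matrix B)"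
    using A B by (intro eq_matI) (auto simp: char_poly_matrix_def)
  then show ?thesis
    unfolding char_poly_def
    using det_four_block_mat_upper_right_zero[OF char_poly_matrix_closed[OF A] refl _
        char_poly_matrix_closed[OF B], of "0\<^sub>m m n"] by simp
qed

text \<open>The matrix is triangularized rather than diagonalized: the base change and its inverse
  have entries 0, 1 and -1 only, so no division by \<open>n\<close> occurs and any commutative ring
  is allowed.\<close>

lemma char_poly_scalar_plus_constant:
  fixes a b :: "'a :: comm_ring_1"
  assumes n: "0 < n"
  shows "char_poly (mat n n (\<lambda>(i, j). if i = j then a + b else b))
    = [:- (a + of_nat n * b), 1:] * [:- a, 1:] ^ (n - 1)"
proof -
  define A where "A = mat n n (\<lambda>(i, j). if i = j then a + b else b)"
  \<comment> \<open>The first column of \<open>P\<close> is the all-ones eigenvector, so \<open>A P = P B\<close> with \<open>B\<close> triangular.\<close>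
  define P where "P = mat n n (\<lambda>(i, j). (if j = i then 1 else 0)
      + (if j = 0 then (if i = 0 then 0 else 1) else 0 :: 'a))"
  \<comment> \<open>The inverse of \<open>P\<close>: the ones below the diagonal in the first column
    change sign.\<close>
  define Q where "Q = mat n n (\<lambda>(i, j). (if j = i then 1 else 0)
      + (if j = 0 then (if i = 0 then 0 else -1) else 0 :: 'a))"
  \<comment> \<open>For \<open>j > 0\<close>, \<open>A\<close> maps the unit vector e_j to a e_j
    plus b times the all-ones vector; the latter part gives the entries \<open>b\<close> in row
    0.\<close>
  define B where "B = mat n n (\<lambda>(i, j). if i = 0 then (if j = 0 then a + of_nat n * b else b)
      else if i = j then a else 0)"
  have carrier: "A \<in> carrier_mat n n" "P \<in> carrier_mat n n" "Q \<in> carrier_mat n n" "B \<in> carrier_mat n n"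
    by (auto simp: A_def P_def Q_def B_def)
  note sums = scalar_prod_def distrib_left distrib_right sum.distrib if_distrib[of "\<lambda>x. x * _"]
    if_distrib[of "\<lambda>x. _ * x"] n
  \<comment> \<open>Nested conditionals are brought into the form
    \<open>if k = i then _ else 0\<close>, so that the sum over \<open>k\<close> collapses to one
    term.\<close>
  have delta: "(if k = 0 then 0 else - (if k = i then 1 else 0 :: 'a))
      = (if k = i then (if i = 0 then 0 else - 1) else 0)"
    "(if k = 0 then 0 else if k = i then 1 else 0 :: 'a)
      = (if k = i then (if i = 0 then 0 else 1) else 0)" for i k :: nat
    by auto
  have PQ: "P * Q = 1\<^sub>m n"
    by (rule eq_matI) (auto simp: P_def Q_def sums delta cong: if_cong)
  have QP: "Q * P = 1\<^sub>m n"
    by (rule eq_matI) (auto simp: P_def Q_def sums delta cong: if_cong)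
  have row_sum: "(\<Sum>k = 0..<n. if i = k then a + b else b) = a + of_nat n * b" if "i < n" for i
  proof -
    have "(\<Sum>k = 0..<n. if i = k then a + b else b) = (\<Sum>k = 0..<n. (if i = k then a else 0) + b)"
      by (rule sum.cong) auto
    then show ?thesis using that by (simp add: sum.distrib)
  qed
  have AP: "A * P = P * B"
  proof (rule eq_matI)
    fix i j assume "i < dim_row (P * B)" and "j < dim_col (P * B)"
    then have ij: "i < n" "j < n" using carrier by auto
    have P0: "P $$ (k, 0) = 1" if "k < n" for k
      using that by (auto simp: P_def)
    \<comment> \<open>Column 0 of \<open>P\<close> is all ones and yields a row sum of
      \<open>A\<close>; every other column is a unit vector and picks out a column of
      \<open>A\<close>.\<close>
    have "(A * P) $$ (i, j) = (if j = 0 then a + of_nat n * b else A $$ (i, j))"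
    proof (cases "j = 0")
      case True
      have "(A * P) $$ (i, 0) = (\<Sum>k = 0..<n. A $$ (i, k))"
        using ij carrier n by (auto simp: scalar_prod_def P0 intro!: sum.cong)
      also have "\<dots> = (\<Sum>k = 0..<n. if i = k then a + b else b)"
        using ij by (intro sum.cong) (auto simp: A_def)
      finally show ?thesis using True row_sum[OF ij(1)] by simp
    next
      case False
      then show ?thesis
        using ij by (auto simp: A_def P_def sums cong: if_cong)
    qed
    also have "\<dots> = (P * B) $$ (i, j)"
    proof -
      have "(if k = 0 then b else if k = j then a else 0)
          = (if k = 0 then b else 0) + (if k = j then a else 0)" if "0 < j" for k
        using that by auto
      then show ?thesis
        using ij by (auto simp: A_def P_def B_def sums cong: if_cong)
    qed
    finally show "(A * P) $$ (i, j) = (P * B) $$ (i, j)" .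
  qed (use carrier in auto)
  have "A = A * (P * Q)" using carrier PQ by simp
  also have "\<dots> = P * B * Q"
    using carrier AP by (metis assoc_mult_mat)
  finally have "similar_mat A B"
    using carrier PQ QP by (intro similar_matI[of _ _ P Q n]) auto
  then have "char_poly A = char_poly B"
    by (rule char_poly_similar)
  also have "\<dots> = (\<Prod>c\<leftarrow>diag_mat B. [:- c, 1:])"
    by (rule char_poly_upper_triangular[of _ n]) (auto simp: B_def)
  also have "diag_mat B = (a + of_nat n * b) # replicate (n - 1) a"
    using n by (intro nth_equalityI) (auto simp: diag_mat_def B_def nth_Cons')
  finally show ?thesis by (simp add: A_def)
qed

section \<open>Spectra of matrices indexed by lists of vertices\<close>

text \<open>Entries depend on vertices, not positions, so the vertex list can be reordered and split
  while \<open>f\<close> stays fixed.\<close>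

definition indexed_mat :: "('a \<Rightarrow> 'a \<Rightarrow> 'b) \<Rightarrow> 'a list \<Rightarrow> 'b mat" where
  "indexed_mat f vs = mat (length vs) (length vs) (\<lambda>(i, j). f (vs ! i) (vs ! j))"

lemma indexed_mat_carrier [simp]: "indexed_mat f vs \<in> carrier_mat (length vs) (length vs)"
  by (simp add: indexed_mat_def)

lemma indexed_mat_cong:
  assumes "\<And>x y. x \<in> set vs \<Longrightarrow> y \<in> set vs \<Longrightarrow> f x y = g x y"
  shows "indexed_mat f vs = indexed_mat g vs"
  by (rule eq_matI) (auto simp: indexed_mat_def assms)

text \<open>Reordering the list permutes rows and columns simultaneously. This allows the vertices
  to be listed class by class.\<close>

lemma char_poly_indexed_mat_mset_eq:
  fixes f :: "'a \<Rightarrow> 'a \<Rightarrow> 'b :: comm_ring_1"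
  assumes "mset vs = mset ws"
  shows "char_poly (indexed_mat f vs) = char_poly (indexed_mat f ws)"
proof -
  obtain p where p: "p permutes {..<length ws}" and vs: "permute_list p ws = vs"
    using mset_eq_permutation[OF assms] .
  have len: "length vs = length ws" using vs by auto
  have lt: "p i < length ws" if "i < length ws" for i
    using permutes_in_image[OF p, of i] that by auto
  have "indexed_mat f vs = mat (length ws) (length ws) (\<lambda>(i, j). indexed_mat f ws $$ (p i, p j))"
    by (rule eq_matI) (auto simp: indexed_mat_def len lt permute_list_nth[OF p] simp flip: vs)
  with char_poly_permute[OF indexed_mat_carrier, of p ws f] p show ?thesis
    by (simp add: lessThan_atLeast0)
qed

lemma eigenvalue_mset_indexed_mat_mset_eq:
  "mset vs = mset ws \<Longrightarrow> eigenvalue_mset (indexed_mat f vs) = eigenvalue_mset (indexed_mat f ws)"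
  unfolding eigenvalue_mset_def using char_poly_indexed_mat_mset_eq by metis

lemma char_poly_nonzero:
  assumes "A \<in> carrier_mat n n"
  shows "char_poly A \<noteq> (0 :: 'a :: comm_ring_1 poly)"
  using degree_monic_char_poly[OF assms] by auto

text \<open>The matrix is block diagonal, so its characteristic polynomial is a product. Both
  factors are monic, hence nonzero, and their root multisets add.\<close>

lemma eigenvalue_mset_indexed_mat_append:
  assumes "\<And>x y. x \<in> set vs \<Longrightarrow> y \<in> set ws \<Longrightarrow> f x y = 0 \<and> f y x = 0"
  shows "eigenvalue_mset (indexed_mat f (vs @ ws))
    = eigenvalue_mset (indexed_mat f vs) + eigenvalue_mset (indexed_mat f ws)"
proof -
  have "indexed_mat f (vs @ ws) = four_block_mat (indexed_mat f vs)
      (0\<^sub>m (length vs) (length ws)) (0\<^sub>m (length ws) (length vs)) (indexed_mat f ws)"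
    by (rule eq_matI) (auto simp: indexed_mat_def nth_append assms)
  then show ?thesis
    unfolding eigenvalue_mset_def
    by (simp add: char_poly_block_diag[OF indexed_mat_carrier indexed_mat_carrier]
        proots_mult char_poly_nonzero[OF indexed_mat_carrier])
qed

text \<open>Induction on the set of blocks: \<open>vs\<close> is rearranged into one block followed
  by a listing \<open>ws\<close> of the others. The induction leaves \<open>vs\<close> arbitrary so
  that its hypothesis applies to \<open>ws\<close>.\<close>

lemma eigenvalue_mset_indexed_mat_partition:
  assumes "finite I"
    and "disjoint_family_on (\<lambda>i. set (l i)) I" and "\<And>i. i \<in> I \<Longrightarrow> distinct (l i)"
    and "distinct vs" and "set vs = (\<Union>i\<in>I. set (l i))"
    and "\<And>i j x y. i \<in> I \<Longrightarrow> j \<in> I \<Longrightarrow> i \<noteq> j \<Longrightarrow> x \<in> set (l i) \<Longrightarrow> y \<in> set (l j) \<Longrightarrow> f x y = 0"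
  shows "eigenvalue_mset (indexed_mat f vs) = (\<Sum>i\<in>I. eigenvalue_mset (indexed_mat f (l i)))"
  using assms
proof (induction I arbitrary: vs rule: finite_induct)
  case empty
  then have "char_poly (indexed_mat f vs) = 1"
    by (simp add: char_poly_def det_dim_zero indexed_mat_def)
  then show ?case by (simp add: eigenvalue_mset_def)
next
  case (insert i I)
  obtain ws where ws: "set ws = (\<Union>i\<in>I. set (l i))" "distinct ws"
    using finite_distinct_list[of "\<Union>i\<in>I. set (l i)"] insert.hyps by auto
  have disj: "set (l i) \<inter> set ws = {}"
    using insert.prems(1) insert.hyps by (fastforce simp: ws disjoint_family_on_def)
  have "mset vs = mset (l i @ ws)"
    using insert.prems ws disj by (subst set_eq_iff_mset_eq_distinct[symmetric]) auto
  then have "eigenvalue_mset (indexed_mat f vs) = eigenvalue_mset (indexed_mat f (l i @ ws))"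
    by (rule eigenvalue_mset_indexed_mat_mset_eq)
  also have "\<dots> = eigenvalue_mset (indexed_mat f (l i)) + eigenvalue_mset (indexed_mat f ws)"
  proof (rule eigenvalue_mset_indexed_mat_append)
    fix x y assume x: "x \<in> set (l i)" and "y \<in> set ws"
    then obtain j where "j \<in> I" "y \<in> set (l j)" using ws by auto
    then show "f x y = 0 \<and> f y x = 0"
      using insert.prems(5)[of i j x y] insert.prems(5)[of j i y x] insert.hyps x by auto
  qed
  also have "eigenvalue_mset (indexed_mat f ws) = (\<Sum>i\<in>I. eigenvalue_mset (indexed_mat f (l i)))"
  proof (rule insert.IH)
    show "disjoint_family_on (\<lambda>i. set (l i)) I"
      using insert.prems(1) by (auto simp: disjoint_family_on_def)
    show "f x y = 0" if "j \<in> I" "k \<in> I" "j \<noteq> k" "x \<in> set (l j)" "y \<in> set (l k)" for j k x y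
      using insert.prems(5)[of j k x y] that by simp
  qed (use insert.prems ws in auto)
  finally show ?case using insert.hyps by simp
qed

lemma eigenvalue_mset_scalar_plus_constant:
  assumes "vs \<noteq> []" and "distinct vs"
  shows "eigenvalue_mset (indexed_mat (\<lambda>x y. if x = y then a + b else b) vs)
    = {#a + of_nat (length vs) * b#} + replicate_mset (length vs - 1) a"
proof -
  \<comment> \<open>Distinctness makes equality of vertices the same as equality of
    positions.\<close>
  have "indexed_mat (\<lambda>x y. if x = y then a + b else b) vs
      = mat (length vs) (length vs) (\<lambda>(i, j). if i = j then a + b else b)"
    using assms by (intro eq_matI) (auto simp: indexed_mat_def nth_eq_iff_index_eq)
  then show ?thesis
    using assms char_poly_scalar_plus_constant[of "length vs" a b]
    \<comment> \<open>The product must stay unexpanded for the rules on roots of products and powers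
      to apply.\<close>
    by (simp add: eigenvalue_mset_def proots_mult proots_power del: mult_pCons_left)
qed

section \<open>Centralizers in AC-groups\<close>

lemma mem_centralizer:
  "y \<in> centralizer G x \<longleftrightarrow> y \<in> carrier G \<and> x \<otimes>\<^bsub>G\<^esub> y = y \<otimes>\<^bsub>G\<^esub> x"
  by (simp add: centralizer_def)

lemma center_subset_centralizer: "x \<in> carrier G \<Longrightarrow> center G \<subseteq> centralizer G x"
  by (auto simp: centralizer_def center_def)

lemma AC_group_centralizer_comm:
  assumes "AC_group G" and "x \<in> carrier G - center G"
    and "y \<in> centralizer G x" and "z \<in> centralizer G x"
  shows "y \<otimes>\<^bsub>G\<^esub> z = z \<otimes>\<^bsub>G\<^esub> y"
proof -
  interpret comm_group "G\<lparr>carrier := centralizer G x\<rparr>"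
    using assms by (auto simp: AC_group_def)
  show ?thesis using m_comm assms by simp
qed

text \<open>If \<open>v\<close> commutes with a non-central \<open>u\<close>, commutativity of
  \<open>centralizer G u\<close> puts it inside \<open>centralizer G v\<close>. Commuting is
  symmetric, so this applies in both directions.\<close>

lemma AC_group_centralizer_eq:
  assumes "AC_group G" and "x \<in> carrier G - center G" and "y \<in> carrier G - center G"
    and "y \<in> centralizer G x"
  shows "centralizer G y = centralizer G x"
proof -
  have le: "centralizer G u \<subseteq> centralizer G v"
    if "u \<in> carrier G - center G" "v \<in> centralizer G u" for u v
    using AC_group_centralizer_comm[OF assms(1) that] by (auto simp: mem_centralizer)
  have "x \<in> centralizer G y" using assms by (auto simp: mem_centralizer)
  then show ?thesis using le assms by blast
qed

theorem theorem2p15: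
  fixes G :: "('a, 'b) monoid_scheme"
    and X :: "nat \<Rightarrow> 'a set" and n :: nat
    and vs :: "'a list"
  assumes "AC_group G"
    and "finite (carrier G)"
    and "\<not> comm_group G"
    and "bij_betw X {1..n} (centralizer G ` (carrier G - center G))"
    and "distinct vs" and "set vs = pverts (commuting_graph G)"
  shows "L_Spec (commuting_graph G) vs =
      replicate_mset n 0
      + (\<Sum>i = 1..n. replicate_mset (card (X i) - card (center G) - 1)
                        (of_nat (card (X i)) - of_nat (card (center G))))
    \<and> Q_Spec (commuting_graph G) vs =
      (\<Sum>i = 1..n. replicate_mset 1
                        (2 * (of_nat (card (X i)) - of_nat (card (center G))) - 2)
                    + replicate_mset (card (X i) - card (center G) - 1)
                        (of_nat (card (X i)) - of_nat (card (center G)) - 2))"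
proof -

  \<comment> \<open>Partition of the vertices by the centralizers\<close>
  let ?\<Gamma> = "commuting_graph G" and ?V = "carrier G - center G"
  have X_vertex: "\<exists>x\<in>?V. X i = centralizer G x" if "i \<in> {1..n}" for i
    using bij_betwE[OF assms(4)] that by blast
  \<comment> \<open>Any non-central element of a class can serve as its representative.\<close>
  have class_eq: "X i = centralizer G x" if i: "i \<in> {1..n}" and x: "x \<in> X i - center G" for i x
  proof -
    obtain z where z: "z \<in> ?V" "X i = centralizer G z" using X_vertex[OF i] by blast
    moreover have "x \<in> ?V" using z x by (simp add: mem_centralizer)
    ultimately show ?thesis using AC_group_centralizer_eq[OF assms(1) z(1), of x] x by simp
  qed
  have finX: "finite (X i)" if "i \<in> {1..n}" for i
    using X_vertex[OF that] assms(2) by (auto simp: centralizer_def)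
  have class_sub: "X i - center G \<subseteq> ?V" if "i \<in> {1..n}" for i
    using X_vertex[OF that] by (auto simp: mem_centralizer)
  have class_ne: "X i - center G \<noteq> {}" if "i \<in> {1..n}" for i
    using X_vertex[OF that] by (auto simp: mem_centralizer)
  have ZX: "center G \<subseteq> X i" if "i \<in> {1..n}" for i
    using X_vertex[OF that] center_subset_centralizer by fastforce
  have cardZ: "card (X i - center G) = card (X i) - card (center G)"
    and card_le: "card (center G) \<le> card (X i)" if "i \<in> {1..n}" for i
    using ZX[OF that] finX[OF that] by (auto intro: card_Diff_subset finite_subset card_mono)
  \<comment> \<open>Both sets equal \<open>centralizer G x\<close>, and \<open>X\<close> is
    injective on the indices.\<close>
  have same_class: "i = j"
    if "i \<in> {1..n}" "j \<in> {1..n}" "x \<in> X i - center G" "x \<in> X j - center G" for i j x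
    using class_eq[OF that(1,3)] class_eq[OF that(2,4)] that(1,2)
      inj_onD[OF bij_betw_imp_inj_on[OF assms(4)], of i j] by simp
  have union: "?V = (\<Union>i\<in>{1..n}. X i - center G)"
  proof
    show "?V \<subseteq> (\<Union>i\<in>{1..n}. X i - center G)"
    proof
      fix x assume x: "x \<in> ?V"
      then have "centralizer G x \<in> X ` {1..n}" using assms(4) by (simp add: bij_betw_def)
      then obtain i where "i \<in> {1..n}" "centralizer G x = X i" by auto
      moreover have "x \<in> centralizer G x" using x by (simp add: mem_centralizer)
      ultimately show "x \<in> (\<Union>i\<in>{1..n}. X i - center G)" using x by blast
    qed
  qed (use class_sub in blast)

  \<comment> \<open>Adjacency and degrees\<close>
  have arc_iff: "(x, y) \<in> parcs ?\<Gamma> \<longleftrightarrow> x \<noteq> y \<and> i = j"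
    if "i \<in> {1..n}" "j \<in> {1..n}" "x \<in> X i - center G" "y \<in> X j - center G" for i j x y
  proof -
    have V: "x \<in> ?V" "y \<in> ?V" using that class_sub by blast+
    have "x \<otimes>\<^bsub>G\<^esub> y = y \<otimes>\<^bsub>G\<^esub> x \<longleftrightarrow> y \<in> X i"
      using V class_eq[OF that(1,3)] by (simp add: mem_centralizer)
    also have "\<dots> \<longleftrightarrow> i = j" using that same_class by blast
    finally show ?thesis using V by (auto simp: commuting_graph_def)
  qed
  have degree: "out_degree (with_proj ?\<Gamma>) x = card (X i) - card (center G) - 1"
    if "i \<in> {1..n}" "x \<in> X i - center G" for i x
  proof -
    have "out_arcs (with_proj ?\<Gamma>) x = Pair x ` (X i - center G - {x})"
    proof -
      \<comment> \<open>Here \<open>y\<close> is arbitrary: a non-vertex is the head of no arc and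
        lies outside the class.\<close>
      have arc: "(x, y) \<in> parcs ?\<Gamma> \<longleftrightarrow> y \<in> X i - center G - {x}" for y
      proof (cases "y \<in> ?V")
        case True
        then obtain j where j: "j \<in> {1..n}" "y \<in> X j - center G" using union by blast
        have "y \<in> X i - center G \<longleftrightarrow> i = j"
          using same_class[OF that(1) j(1) _ j(2)] j(2) by metis
        then show ?thesis using arc_iff[OF that(1) j(1) that(2) j(2)] by auto
      next
        case False
        then show ?thesis using class_sub[OF that(1)] by (auto simp: commuting_graph_def)
      qed
      show ?thesis
      proof (rule Set.set_eqI)
        fix e
        show "e \<in> out_arcs (with_proj ?\<Gamma>) x \<longleftrightarrow> e \<in> Pair x ` (X i - center G - {x})"
          using arc[of "snd e"] by (cases e) (simp add: out_arcs_def image_iff, blast)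
      qed
    qed
    then have "out_degree (with_proj ?\<Gamma>) x = card (X i - center G - {x})"
      by (simp add: out_degree_def card_image inj_on_def)
    then show ?thesis using that cardZ by simp
  qed

  \<comment> \<open>Spectrum of the degree matrix plus a multiple of the adjacency matrix\<close>
  define l where "l i = (SOME xs. set xs = X i - center G \<and> distinct xs)" for i
  have l: "set (l i) = X i - center G" "distinct (l i)" if "i \<in> {1..n}" for i
    using someI_ex[OF finite_distinct_list[of "X i - center G"]] finX[OF that]
    by (auto simp: l_def)
  have len: "length (l i) = card (X i) - card (center G)" and len_pos: "l i \<noteq> []"
    if "i \<in> {1..n}" for i
    using l[OF that] cardZ[OF that] class_ne[OF that] by (auto simp flip: distinct_card)
  have card_pos: "0 < card (X i) - card (center G)" if "i \<in> {1..n}" for i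
    using len[OF that] len_pos[OF that] by (metis length_greater_0_conv)
  \<comment> \<open>The parameter \<open>c\<close> scales the adjacency part, so one computation
    serves both spectra.\<close>
  have spectrum: "eigenvalue_mset (indexed_mat f vs) = (\<Sum>i = 1..n.
      replicate_mset 1 ((1 + c) * (of_nat (card (X i)) - of_nat (card (center G))) - 1 - c)
      + replicate_mset (card (X i) - card (center G) - 1)
          (of_nat (card (X i)) - of_nat (card (center G)) - 1 - c))"
    if f: "f = (\<lambda>x y. (if x = y then of_nat (out_degree (with_proj ?\<Gamma>) x) else 0)
             + c * (if (x, y) \<in> parcs ?\<Gamma> then 1 else 0))" for f and c :: complex
  proof -
    have "eigenvalue_mset (indexed_mat f vs)
        = (\<Sum>i = 1..n. eigenvalue_mset (indexed_mat f (l i)))"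
    proof (rule eigenvalue_mset_indexed_mat_partition)
      show "disjoint_family_on (\<lambda>i. set (l i)) {1..n}"
        unfolding disjoint_family_on_def
      proof (intro ballI impI)
        fix i j assume "i \<in> {1..n}" "j \<in> {1..n}" "i \<noteq> j"
        then show "set (l i) \<inter> set (l j) = {}"
          using same_class[of i j] l(1)[of i] l(1)[of j] by auto
      qed
      show "set vs = (\<Union>i\<in>{1..n}. set (l i))"
        using assms(6) union l by (simp add: commuting_graph_def)
      show "f x y = 0" if "i \<in> {1..n}" "j \<in> {1..n}" "i \<noteq> j" "x \<in> set (l i)" "y \<in> set (l j)" for i j x y
        using that arc_iff[of i j x y] same_class[of i j x] l(1)[of i] l(1)[of j] by (auto simp: f)
    qed (use assms(5) l in auto)
    also have "\<dots> = (\<Sum>i = 1..n.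
        replicate_mset 1 ((1 + c) * (of_nat (card (X i)) - of_nat (card (center G))) - 1 - c)
        + replicate_mset (card (X i) - card (center G) - 1)
            (of_nat (card (X i)) - of_nat (card (center G)) - 1 - c))"
    proof (rule sum.cong[OF refl])
      fix i assume i: "i \<in> {1..n}"
      define m where "m = card (X i) - card (center G)"
      have m: "of_nat (card (X i)) - of_nat (card (center G)) = (of_nat m :: complex)"
        using card_le[OF i] by (simp add: m_def of_nat_diff)
      \<comment> \<open>Positivity makes the truncated difference \<open>m - 1\<close>, the degree,
        agree with the complex one.\<close>
      have m_pos: "0 < m" using card_pos[OF i] by (simp add: m_def)
      \<comment> \<open>The diagonal entry \<open>m - 1\<close> is split to match a I + b J with a =
        m - 1 - c and b = c; then a + m b = (1 + c) m - 1 - c.\<close>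
      have "indexed_mat f (l i) = indexed_mat (\<lambda>x y. if x = y then (of_nat m - 1 - c) + c else c) (l i)"
      proof (rule indexed_mat_cong)
        fix x y assume "x \<in> set (l i)" "y \<in> set (l i)"
        then have xy: "x \<in> X i - center G" "y \<in> X i - center G" using l(1)[OF i] by auto
        show "f x y = (if x = y then (of_nat m - 1 - c) + c else c)"
          using arc_iff[OF i i xy] arc_iff[OF i i xy(1,1)] degree[OF i xy(1)] m_pos
          by (cases "x = y") (simp_all add: f of_nat_diff flip: m_def)
      qed
      then have "eigenvalue_mset (indexed_mat f (l i))
          = {#(of_nat m - 1 - c) + of_nat m * c#} + replicate_mset (m - 1) (of_nat m - 1 - c)"
        using eigenvalue_mset_scalar_plus_constant[OF len_pos[OF i] l(2)[OF i]] len[OF i]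
        by (simp add: m_def)
      then show "eigenvalue_mset (indexed_mat f (l i))
          = replicate_mset 1 ((1 + c) * (of_nat (card (X i)) - of_nat (card (center G))) - 1 - c)
            + replicate_mset (card (X i) - card (center G) - 1)
                (of_nat (card (X i)) - of_nat (card (center G)) - 1 - c)"
        unfolding m by (simp add: algebra_simps flip: m_def)
    qed
    finally show ?thesis .
  qed
  \<comment> \<open>The Laplacian is the case \<open>c = -1\<close> and the signless Laplacian the case \<open>c = 1\<close>.\<close>
  have mats: "degree_mat ?\<Gamma> vs - adjacency_mat ?\<Gamma> vs = indexed_mat (\<lambda>x y.
        (if x = y then of_nat (out_degree (with_proj ?\<Gamma>) x) else 0)
        + (- 1) * (if (x, y) \<in> parcs ?\<Gamma> then 1 else 0)) vs"
    "degree_mat ?\<Gamma> vs + adjacency_mat ?\<Gamma> vs = indexed_mat (\<lambda>x y.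
        (if x = y then of_nat (out_degree (with_proj ?\<Gamma>) x) else 0)
        + 1 * (if (x, y) \<in> parcs ?\<Gamma> then 1 else 0)) vs"
    using assms(5)
    by (auto intro!: eq_matI
        simp: degree_mat_def adjacency_mat_def indexed_mat_def nth_eq_iff_index_eq)
  \<comment> \<open>In the Laplacian case the all-ones eigenvalue of every class is 0; these
    \<open>n\<close> zeros are collected in front.\<close>
  have zeros: "(\<Sum>i = 1..n. add_mset 0 (M i)) = replicate_mset n 0 + (\<Sum>i = 1..n. M i)"
    for M :: "nat \<Rightarrow> complex multiset"
    by (induction n) auto
  show ?thesis
    unfolding L_Spec_def Q_Spec_def mats spectrum[OF refl]
    using zeros by simp
qed

end
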